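(* For all integers $m\ge 3$ and $k\ge -1$, $M(m,2m+2k)\le 3m+k-2$.
   Context: Let $a_1<\cdots<a_m$ and $b_1<\cdots<b_n$ be two sorted lists whose $m+n$ elements are distinct and whose interleaving is unknown. A deterministic merging algorithm learns information only through pairwise comparisons between elements and must determine the full linear order of all $m+n$ elements. $M(m,n)$ is the minimum over all such algorithms of the worst-case number of comparisons used. *)

theory Defs
  imports Main
begin

text \<open>Indices are 0-based: \<open>A i\<close> stands for $a_{i+1}$ and \<open>B j\<close> for $b_{j+1}$.\<close>

datatype elem = A nat | B nat

definition elems :: "nat \<Rightarrow> nat \<Rightarrow> elem set" where
  "elems m n = A ` {..<m} \<union> B ` {..<n}"

text \<open>The possible inputs: all strict linear orders on the \<open>m + n\<close> elements that
  extend the known orders of the two lists. \<open>(x, y) \<in> R\<close> means \<open>x\<close> is smaller than \<open>y\<close>.\<close>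

definition interleavings :: "nat \<Rightarrow> nat \<Rightarrow> elem rel set" where
  "interleavings m n = {R. R \<subseteq> elems m n \<times> elems m n
     \<and> strict_linear_order_on (elems m n) R
     \<and> (\<forall>i j. i < j \<and> j < m \<longrightarrow> (A i, A j) \<in> R)
     \<and> (\<forall>i j. i < j \<and> j < n \<longrightarrow> (B i, B j) \<in> R)}"

text \<open>A deterministic comparison algorithm is a binary decision tree. \<open>Compare x y S T\<close>
  compares \<open>x\<close> with \<open>y\<close>, continuing with \<open>S\<close> if \<open>x\<close> is smaller and with \<open>T\<close> otherwise;
  \<open>Output R\<close> stops and announces the linear order \<open>R\<close>.\<close>

datatype algorithm =
    Output "elem rel"
  | Compare elem elem algorithm algorithm

primrec run :: "algorithm \<Rightarrow> elem rel \<Rightarrow> elem rel" where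
  "run (Output R') R = R'"
| "run (Compare x y S T) R = (if (x, y) \<in> R then run S R else run T R)"

primrec comparisons :: "algorithm \<Rightarrow> elem rel \<Rightarrow> nat" where
  "comparisons (Output R') R = 0"
| "comparisons (Compare x y S T) R = Suc (if (x, y) \<in> R then comparisons S R else comparisons T R)"

primrec compares_within :: "elem set \<Rightarrow> algorithm \<Rightarrow> bool" where
  "compares_within E (Output R') \<longleftrightarrow> True"
| "compares_within E (Compare x y S T) \<longleftrightarrow>
     x \<in> E \<and> y \<in> E \<and> x \<noteq> y \<and> compares_within E S \<and> compares_within E T"

definition merging_algorithm :: "nat \<Rightarrow> nat \<Rightarrow> algorithm \<Rightarrow> bool" where
  "merging_algorithm m n T \<longleftrightarrow>
     compares_within (elems m n) T \<and> (\<forall>R \<in> interleavings m n. run T R = R)"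

definition worst_case :: "nat \<Rightarrow> nat \<Rightarrow> algorithm \<Rightarrow> nat" where
  "worst_case m n T = Max (comparisons T ` interleavings m n)"

definition M :: "nat \<Rightarrow> nat \<Rightarrow> nat" where
  "M m n = (LEAST c. \<exists>T. merging_algorithm m n T \<and> worst_case m n T = c)"

text \<open>The maximum and the minimum above are taken over nonempty sets, the former finite,
  so both are attained.\<close>

lemma finite_elems [simp]: "finite (elems m n)"
  by (simp add: elems_def)

lemma finite_interleavings [simp]: "finite (interleavings m n)"
  by (rule finite_subset[of _ "Pow (elems m n \<times> elems m n)"]) (auto simp: interleavings_def)

lemma interleavings_nonempty: "interleavings m n \<noteq> {}"
proof -
  define key where "key x = (case x of A i \<Rightarrow> i | B j \<Rightarrow> m + j)" for x
  define R where "R = {(x, y). x \<in> elems m n \<and> y \<in> elems m n \<and> key x < key y}"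
  have "inj_on key (elems m n)"
    by (auto simp: inj_on_def elems_def key_def)
  then have "total_on (elems m n) R"
    unfolding total_on_def R_def inj_on_def by (simp, meson linorder_neqE_nat)
  moreover have "trans R" "irrefl R"
    by (auto simp: R_def irrefl_def intro: transI)
  moreover have "R \<subseteq> elems m n \<times> elems m n" by (auto simp: R_def)
  moreover have "\<forall>i j. i < j \<and> j < m \<longrightarrow> (A i, A j) \<in> R" "\<forall>i j. i < j \<and> j < n \<longrightarrow> (B i, B j) \<in> R"
    by (auto simp: R_def elems_def key_def)
  ultimately have "R \<in> interleavings m n"
    by (simp add: interleavings_def strict_linear_order_on_def)
  then show ?thesis by blast
qed

lemma merging_algorithm_exists: "\<exists>T. merging_algorithm m n T"
proof -
  have *: "\<exists>T. compares_within (elems m n) T \<and> (\<forall>R. run T R = Q \<union> (P \<inter> R))"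
    if "finite P" "P \<subseteq> elems m n \<times> elems m n - Id" for P Q
    using that
  proof (induction P arbitrary: Q rule: finite_induct)
    case empty
    show ?case by (rule exI[of _ "Output Q"]) simp
  next
    case (insert p P)
    obtain x y where p: "p = (x, y)" by fastforce
    have xy: "x \<in> elems m n" "y \<in> elems m n" "x \<noteq> y"
      using insert.prems p by auto
    have P: "P \<subseteq> elems m n \<times> elems m n - Id"
      using insert.prems by simp
    obtain S where S: "compares_within (elems m n) S" "\<And>R. run S R = insert p Q \<union> (P \<inter> R)"
      using insert.IH[OF P, of "insert p Q"] by metis
    obtain T where T: "compares_within (elems m n) T" "\<And>R. run T R = Q \<union> (P \<inter> R)"
      using insert.IH[OF P, of Q] by metis
    have "run (Compare x y S T) R = Q \<union> (insert p P \<inter> R)" for R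
      by (simp add: p S(2) T(2))
    moreover have "compares_within (elems m n) (Compare x y S T)"
      using xy S(1) T(1) by simp
    ultimately show ?case by blast
  qed
  obtain T where T: "compares_within (elems m n) T"
      "\<forall>R. run T R = {} \<union> ((elems m n \<times> elems m n - Id) \<inter> R)"
    using *[of "elems m n \<times> elems m n - Id" "{}"] finite_elems[of m n]
    by (metis finite_Diff finite_SigmaI order_refl)
  have "run T R = R" if "R \<in> interleavings m n" for R
  proof -
    have "R \<subseteq> elems m n \<times> elems m n - Id"
      using that unfolding interleavings_def strict_linear_order_on_def irrefl_def by blast
    then show ?thesis unfolding T(2)[rule_format] by blast
  qed
  then show ?thesis using T(1) by (auto simp: merging_algorithm_def)
qed

lemma M_attained: "\<exists>T. merging_algorithm m n T \<and> worst_case m n T = M m n"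
  unfolding M_def by (rule LeastI_ex) (use merging_algorithm_exists in blast)

end

theory Submission
  imports Defs
begin

text \<open>An interleaving is encoded by the weakly increasing list whose entry \<open>i\<close> is the number of
  \<open>B\<close>s below \<open>A i\<close>; comparing \<open>A i\<close> with \<open>B j\<close> asks whether that entry is at most \<open>j\<close>.

  Comparing $a_1$ with $b_2$, and then with $b_1$ if $a_1 < b_2$, gives
  $M(m+1,n) \le \max(M(m,n)+2,\; M(m+1,n-2)+1)$. The claimed bound is compatible with this recursion,
  so induction on $m$ and $k$ reduces it to $k = -1$, where it is the tape merge bound $m+n-1$,
  and to $m = 3$. There the recursion starts from $M(3,6) \le 7$ and $M(2,8) \le 6$, which come from
  short explicit strategies: a few comparisons confine every entry of the list to an interval,
  and the entries are then found by independent binary searches.\<close>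

section \<open>Identification by yes/no queries\<close>

text \<open>Decision trees of depth at most \<open>c\<close>, abstract in the type of candidates:
  the same notion serves position vectors, where strategies are built, and order relations, where
  they become algorithms.\<close>

inductive identifiable :: "('s \<Rightarrow> bool) set \<Rightarrow> 's set \<Rightarrow> nat \<Rightarrow> bool" for Q where
  leaf: "(\<And>x y. x \<in> S \<Longrightarrow> y \<in> S \<Longrightarrow> x = y) \<Longrightarrow> identifiable Q S c"
| node: "q \<in> Q \<Longrightarrow> identifiable Q {x \<in> S. q x} c \<Longrightarrow> identifiable Q {x \<in> S. \<not> q x} c
    \<Longrightarrow> identifiable Q S (Suc c)"

lemma identifiable_mono:
  assumes "identifiable Q S c" "c \<le> d"
  shows "identifiable Q S d"
  using assms
proof (induction arbitrary: d)
  case (leaf S c)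
  then show ?case by (blast intro: identifiable.leaf)
next
  case (node q S c)
  then obtain d' where "d = Suc d'" "c \<le> d'" by (cases d) auto
  then show ?case using node by (blast intro: identifiable.node)
qed

text \<open>A strategy is pulled back along \<open>g\<close> by replacing each query
  \<open>q\<close> with one that gives its answer at \<open>g x\<close>; injectivity keeps at most
  one candidate at every leaf.\<close>

lemma identifiable_transfer:
  assumes "identifiable Q S c" "inj_on g S'" "g ` S' \<subseteq> S"
    and "\<And>q. q \<in> Q \<Longrightarrow> \<exists>q'\<in>Q'. \<forall>x\<in>S'. q' x = q (g x)"
  shows "identifiable Q' S' c"
  using assms
proof (induction arbitrary: S')
  case (leaf S c)
  then show ?case by (intro identifiable.leaf) (meson imageI inj_onD subsetD)
next
  case (node q S c)
  obtain q' where q': "q' \<in> Q'" "\<forall>x\<in>S'. q' x = q (g x)"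
    using node.prems(3) node.hyps(1) by blast
  have "identifiable Q' {x \<in> S'. q' x} c"
  proof (rule node.IH(1))
    show "inj_on g {x \<in> S'. q' x}" using node.prems(1) by (auto intro: inj_on_subset)
    show "g ` {x \<in> S'. q' x} \<subseteq> {x \<in> S. q x}" using node.prems(2) q' by auto
    show "\<exists>r'\<in>Q'. \<forall>x\<in>{x \<in> S'. q' x}. r' x = r (g x)" if "r \<in> Q" for r
      using node.prems(3)[OF that] by auto
  qed
  moreover have "identifiable Q' {x \<in> S'. \<not> q' x} c"
  proof (rule node.IH(2))
    show "inj_on g {x \<in> S'. \<not> q' x}" using node.prems(1) by (auto intro: inj_on_subset)
    show "g ` {x \<in> S'. \<not> q' x} \<subseteq> {x \<in> S. \<not> q x}" using node.prems(2) q' by auto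
    show "\<exists>r'\<in>Q'. \<forall>x\<in>{x \<in> S'. \<not> q' x}. r' x = r (g x)" if "r \<in> Q" for r
      using node.prems(3)[OF that] by auto
  qed
  ultimately show ?case using q'(1) by (rule identifiable.node[rotated])
qed

section \<open>Position vectors\<close>

definition positions :: "nat \<Rightarrow> nat \<Rightarrow> nat list set" where
  "positions m n = {v. length v = m \<and> sorted v \<and> (\<forall>x\<in>set v. x \<le> n)}"

definition queries :: "nat \<Rightarrow> nat \<Rightarrow> (nat list \<Rightarrow> bool) set" where
  "queries m n = {\<lambda>v. v ! i \<le> j | i j. i < m \<and> j < n}"

lemma queriesI: "i < m \<Longrightarrow> j < n \<Longrightarrow> (\<lambda>v. v ! i \<le> j) \<in> queries m n"
  by (auto simp: queries_def)

lemma identifiable_query: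
  assumes "i < m" "j < n"
    and "identifiable (queries m n) {v \<in> S. v ! i \<le> j} c"
    and "identifiable (queries m n) {v \<in> S. j < v ! i} c"
  shows "identifiable (queries m n) S (Suc c)"
  using assms by (intro identifiable.node[of "\<lambda>v. v ! i \<le> j"]) (auto simp: queries_def not_le)

text \<open>Binary search in each coordinate separately: a query halves one interval and lowers its
  exponent by one, so the exponents add up to the number of queries.\<close>

lemma identifiable_box:
  assumes "\<And>v. v \<in> S \<Longrightarrow> length v = m"
    and "\<And>v i. v \<in> S \<Longrightarrow> i < m \<Longrightarrow> lo i \<le> v ! i \<and> v ! i < lo i + 2 ^ e i \<and> v ! i \<le> n"
    and "(\<Sum>i<m. e i) \<le> c"
  shows "identifiable (queries m n) S c"
  using assms
proof (induction c arbitrary: S lo e)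
  case 0
  have "v ! i = lo i" if "v \<in> S" "i < m" for v i
    using 0(2)[OF that] 0(3) that by simp
  then show ?case
    by (intro identifiable.leaf nth_equalityI) (auto simp: 0(1))
next
  case (Suc c)
  show ?case
  proof (cases "\<forall>i<m. e i = 0")
    case True
    then have "(\<Sum>i<m. e i) \<le> c" by simp
    then show ?thesis
      using Suc.IH[OF Suc.prems(1,2)] by (blast intro: identifiable_mono le_SucI)
  next
    case False
    then obtain i k where i: "i < m" and k: "e i = Suc k"
      by (metis not0_implies_Suc)
    \<comment> \<open>\<open>h\<close> is the first value of the upper half of interval
      \<open>i\<close>, so the splitting query has threshold \<open>h - 1\<close>.\<close>
    define h where "h = lo i + 2 ^ k"
    have h: "0 < h" by (simp add: h_def)
    have "(\<Sum>x<m. e x) = e i + (\<Sum>x\<in>{..<m} - {i}. e x)"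
      using i by (intro sum.remove) auto
    moreover have "(\<Sum>x<m. (e(i := k)) x) = k + (\<Sum>x\<in>{..<m} - {i}. (e(i := k)) x)"
      using i by (subst sum.remove[of _ i]) auto
    moreover have "(\<Sum>x\<in>{..<m} - {i}. (e(i := k)) x) = (\<Sum>x\<in>{..<m} - {i}. e x)"
      by (intro sum.cong) auto
    ultimately have sum: "(\<Sum>x<m. (e(i := k)) x) \<le> c"
      using Suc.prems(3) k by linarith
    have low: "identifiable (queries m n) {v \<in> S. v ! i \<le> h - 1} c"
    proof (rule Suc.IH[OF _ _ sum, of _ lo])
      fix v x assume v: "v \<in> {v \<in> S. v ! i \<le> h - 1}" and x: "x < m"
      have "v ! i < h" using v h by auto
      then show "lo x \<le> v ! x \<and> v ! x < lo x + 2 ^ (e(i := k)) x \<and> v ! x \<le> n"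
        using Suc.prems(2)[of v x] v x by (auto simp: h_def)
    qed (use Suc.prems(1) in auto)
    have high: "identifiable (queries m n) {v \<in> S. h - 1 < v ! i} c"
    proof (rule Suc.IH[OF _ _ sum, of _ "lo(i := h)"])
      fix v x assume "v \<in> {v \<in> S. h - 1 < v ! i}" "x < m"
      then show "(lo(i := h)) x \<le> v ! x \<and> v ! x < (lo(i := h)) x + 2 ^ (e(i := k)) x \<and> v ! x \<le> n"
        using Suc.prems(2)[of v x] h k by (auto simp: h_def)
    qed (use Suc.prems(1) in auto)
    \<comment> \<open>If \<open>h - 1 \<ge> n\<close>, there is no \<open>B (h - 1)\<close> to
      compare with. But then every entry, being at most \<open>n\<close>, lies in the lower half,
      and no query is spent.\<close>
    show ?thesis
    proof (cases "h - 1 < n")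
      case True
      show ?thesis by (rule identifiable_query[OF i True low high])
    next
      case False
      then have "v ! i \<le> h - 1" if "v \<in> S" for v
        using Suc.prems(2)[OF that i] by simp
      then have "{v \<in> S. v ! i \<le> h - 1} = S" by blast
      then show ?thesis using low by (auto intro: identifiable_mono)
    qed
  qed
qed

section \<open>Reductions to smaller instances\<close>

definition mergeable :: "nat \<Rightarrow> nat \<Rightarrow> nat \<Rightarrow> bool" where
  "mergeable m n c \<longleftrightarrow> identifiable (queries m n) (positions m n) c"

lemma sorted_hd_le: "sorted v \<Longrightarrow> y \<in> set v \<Longrightarrow> v ! 0 \<le> y"
  by (cases v) auto

text \<open>Once the place of $a_1$ is known, the other elements of its list are merged with all
  \<open>n\<close> elements of the second list. Forgetting that their entries are at least
  \<open>x\<close> only enlarges the set of candidates.\<close>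

lemma mergeable_tl:
  assumes "mergeable m n c"
  shows "identifiable (queries (Suc m) n) {v \<in> positions (Suc m) n. v ! 0 = x} c"
proof (rule identifiable_transfer[of _ _ _ tl])
  show "identifiable (queries m n) (positions m n) c" using assms by (simp add: mergeable_def)
  have Cons: "v = x # tl v" if "v \<in> {v \<in> positions (Suc m) n. v ! 0 = x}" for v
    using that by (cases v) (auto simp: positions_def)
  show "inj_on tl {v \<in> positions (Suc m) n. v ! 0 = x}"
  proof (rule inj_onI)
    fix v w
    assume "v \<in> {v \<in> positions (Suc m) n. v ! 0 = x}" "w \<in> {v \<in> positions (Suc m) n. v ! 0 = x}"
      "tl v = tl w"
    then show "v = w" using Cons[of v] Cons[of w] by simp
  qed
  show "tl ` {v \<in> positions (Suc m) n. v ! 0 = x} \<subseteq> positions m n"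
  proof (rule image_subsetI)
    fix v assume "v \<in> {v \<in> positions (Suc m) n. v ! 0 = x}"
    then show "tl v \<in> positions m n" by (cases v) (auto simp: positions_def)
  qed
  show "\<exists>q'\<in>queries (Suc m) n. \<forall>v\<in>{v \<in> positions (Suc m) n. v ! 0 = x}. q' v = q (tl v)"
    if q: "q \<in> queries m n" for q
  proof -
    obtain i j where "i < m" "j < n" "q = (\<lambda>v. v ! i \<le> j)"
      using q by (auto simp: queries_def)
    then show ?thesis
      by (intro bexI[of _ "\<lambda>v. v ! Suc i \<le> j"])
        (auto simp: positions_def nth_tl intro!: queriesI)
  qed
qed

text \<open>If the first \<open>s\<close> elements of the second list lie below $a_1$, they lie
  below the whole first list and can be discarded; all entries then shift down by
  \<open>s\<close>.\<close>

lemma mergeable_drop: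
  assumes "mergeable m (n - s) c" "s \<le> n" "0 < m"
  shows "identifiable (queries m n) {v \<in> positions m n. s \<le> v ! 0} c"
proof -
  let ?S = "{v \<in> positions m n. s \<le> v ! 0}"
  let ?g = "map (\<lambda>y. y - s)"
  have ge: "s \<le> y" if "v \<in> ?S" "y \<in> set v" for v y
    using that sorted_hd_le[of v y] by (auto simp: positions_def)
  show ?thesis
  proof (rule identifiable_transfer[of _ _ _ ?g])
    show "identifiable (queries m (n - s)) (positions m (n - s)) c"
      using assms(1) by (simp add: mergeable_def)
    show "inj_on ?g ?S"
    proof (rule inj_onI)
      fix v w assume vw: "v \<in> ?S" "w \<in> ?S" "?g v = ?g w"
      have "map (\<lambda>y. y + s) (?g u) = u" if "u \<in> ?S" for u
        using ge[OF that] by (auto intro: map_idI)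
      then show "v = w" using vw by metis
    qed
    show "?g ` ?S \<subseteq> positions m (n - s)"
      by (auto simp: positions_def sorted_iff_nth_mono diff_le_mono)
    show "\<exists>q'\<in>queries m n. \<forall>v\<in>?S. q' v = q (?g v)" if q: "q \<in> queries m (n - s)" for q
    proof -
      obtain i j where "i < m" "j < n - s" "q = (\<lambda>v. v ! i \<le> j)"
        using q by (auto simp: queries_def)
      then show ?thesis
        by (intro bexI[of _ "\<lambda>v. v ! i \<le> j + s"])
          (auto simp: positions_def le_diff_conv intro!: queriesI)
    qed
  qed
qed

lemma mergeable_0: "mergeable 0 n c" "mergeable m 0 c"
  unfolding mergeable_def
  by (rule identifiable.leaf;
      auto simp: positions_def all_set_conv_all_nth intro!: nth_equalityI)+

text \<open>Binary insertion: a single element has \<open>n + 1\<close> possible places.\<close>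

lemma mergeable_1:
  assumes "n < 2 ^ c"
  shows "mergeable 1 n c"
  unfolding mergeable_def
  by (rule identifiable_box[where lo = "\<lambda>_. 0" and e = "\<lambda>_. c"])
    (use assms in \<open>auto simp: positions_def in_set_conv_nth intro: le_less_trans\<close>)

section \<open>Merging strategies\<close>

text \<open>The tape merge step: $a_1$ is compared with $b_1$, and the smaller one is
  removed.\<close>

lemma mergeable_compare_first:
  assumes "mergeable m (Suc n) c" "mergeable (Suc m) n c"
  shows "mergeable (Suc m) (Suc n) (Suc c)"
  unfolding mergeable_def
proof (rule identifiable_query[of 0 _ 0])
  show "identifiable (queries (Suc m) (Suc n)) {v \<in> positions (Suc m) (Suc n). v ! 0 \<le> 0} c"
    using mergeable_tl[OF assms(1), of 0] by simp
  show "identifiable (queries (Suc m) (Suc n)) {v \<in> positions (Suc m) (Suc n). 0 < v ! 0} c"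
    using mergeable_drop[of "Suc m" "Suc n" 1 c] assms(2) by (simp add: Suc_le_eq)
qed simp_all

text \<open>If $a_1 > b_2$, one comparison has disposed of two elements of the second list;
  otherwise a second comparison, with $b_1$, fixes $a_1$. Hence the two hypotheses have budgets
  differing by one.\<close>

lemma mergeable_compare_second:
  assumes "mergeable m (n + 2) c" "mergeable (Suc m) n (Suc c)"
  shows "mergeable (Suc m) (n + 2) (Suc (Suc c))"
  unfolding mergeable_def
proof (rule identifiable_query[of 0 _ 1])
  let ?S = "{v \<in> positions (Suc m) (n + 2). v ! 0 \<le> 1}"
  have "{v \<in> ?S. v ! 0 \<le> 0} = {v \<in> positions (Suc m) (n + 2). v ! 0 = 0}"
    "{v \<in> ?S. 0 < v ! 0} = {v \<in> positions (Suc m) (n + 2). v ! 0 = 1}"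
    by auto
  then show "identifiable (queries (Suc m) (n + 2)) ?S (Suc c)"
    using mergeable_tl[OF assms(1), of 0] mergeable_tl[OF assms(1), of 1]
    by (intro identifiable_query[of 0 _ 0]) simp_all
  have "{v \<in> positions (Suc m) (n + 2). 1 < v ! 0} = {v \<in> positions (Suc m) (n + 2). 2 \<le> v ! 0}"
    by auto
  then show "identifiable (queries (Suc m) (n + 2)) {v \<in> positions (Suc m) (n + 2). 1 < v ! 0} (Suc c)"
    using mergeable_drop[of "Suc m" "n + 2" 2 "Suc c"] assms(2) by simp
qed simp_all

lemma mergeable_tape: "mergeable m n (m + n - 1)"
\<comment> \<open>Either list may lose its first element, so the induction is on the total
  length.\<close>
proof (induction "m + n" arbitrary: m n)
  case 0
  then show ?case by (simp add: mergeable_0)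
next
  case (Suc s)
  show ?case
  proof (cases "m = 0 \<or> n = 0")
    case True
    then show ?thesis by (auto simp: mergeable_0)
  next
    case False
    then obtain m' n' where "m = Suc m'" "n = Suc n'"
      by (metis not0_implies_Suc)
    then show ?thesis
      using Suc.hyps(1)[of m' n] Suc.hyps(1)[of m n'] Suc.hyps(2)
      by (auto intro: mergeable_compare_first)
  qed
qed

section \<open>Explicit strategies for two and three elements\<close>

lemma positions_2:
  "v \<in> positions 2 n \<Longrightarrow> length v = 2 \<and> v ! 0 \<le> v ! 1 \<and> v ! 1 \<le> n"
  by (auto simp: positions_def sorted_iff_nth_mono)

lemma positions_3:
  "v \<in> positions 3 n \<Longrightarrow> length v = 3 \<and> v ! 0 \<le> v ! 1 \<and> v ! 1 \<le> v ! 2 \<and> v ! 2 \<le> n"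
  by (auto simp: positions_def sorted_iff_nth_mono)

text \<open>The box is given by literal numbers, a lower end and an exponent for each entry in turn,
  so that each leaf of an explicit strategy is checked by arithmetic.\<close>

lemma identifiable_box_2:
  assumes "\<And>v. v \<in> S \<Longrightarrow> v \<in> positions 2 n \<and> l0 \<le> v ! 0 \<and> v ! 0 < l0 + 2 ^ e0
    \<and> l1 \<le> v ! 1 \<and> v ! 1 < l1 + 2 ^ e1"
    and "e0 + e1 \<le> c"
  shows "identifiable (queries 2 n) S c"
proof (rule identifiable_box[where lo = "\<lambda>i. [l0, l1] ! i" and e = "\<lambda>i. [e0, e1] ! i"])
  fix v and i :: nat assume v: "v \<in> S" and i: "i < 2"
  then consider "i = 0" | "i = 1" by linarith
  then show "[l0, l1] ! i \<le> v ! i \<and> v ! i < [l0, l1] ! i + 2 ^ ([e0, e1] ! i) \<and> v ! i \<le> n"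
    using assms(1)[OF v] positions_2[of v n] by cases auto
qed (use assms positions_2 in \<open>auto simp: numeral_2_eq_2\<close>)

lemma identifiable_box_3:
  assumes "\<And>v. v \<in> S \<Longrightarrow> v \<in> positions 3 n \<and> l0 \<le> v ! 0 \<and> v ! 0 < l0 + 2 ^ e0
    \<and> l1 \<le> v ! 1 \<and> v ! 1 < l1 + 2 ^ e1 \<and> l2 \<le> v ! 2 \<and> v ! 2 < l2 + 2 ^ e2"
    and "e0 + e1 + e2 \<le> c"
  shows "identifiable (queries 3 n) S c"
proof (rule identifiable_box[where lo = "\<lambda>i. [l0, l1, l2] ! i" and e = "\<lambda>i. [e0, e1, e2] ! i"])
  fix v and i :: nat assume v: "v \<in> S" and i: "i < 3"
  then consider "i = 0" | "i = 1" | "i = 2" by linarith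
  then show "[l0, l1, l2] ! i \<le> v ! i \<and> v ! i < [l0, l1, l2] ! i + 2 ^ ([e0, e1, e2] ! i) \<and> v ! i \<le> n"
    using assms(1)[OF v] positions_3[of v n] by cases auto
qed (use assms positions_3 in \<open>auto simp: numeral_3_eq_3\<close>)

text \<open>Compare $a_1$ with $b_3$, then with $b_1$ or $b_5$ according to the outcome. Each of the
  four cases lies in a box with exponents of sum 4.\<close>

lemma mergeable_2_8: "mergeable 2 8 6"
proof -
  let ?Q = "queries 2 8" and ?P = "positions 2 8"
  note bounds = positions_2[of _ 8]
  have "identifiable ?Q {v \<in> {v \<in> ?P. v ! 0 \<le> 2}. v ! 0 \<le> 0} 4"
    by (rule identifiable_box_2[of _ _ 0 0 0 4]) (auto dest: bounds)
  moreover have "identifiable ?Q {v \<in> {v \<in> ?P. v ! 0 \<le> 2}. 0 < v ! 0} 4"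
    by (rule identifiable_box_2[of _ _ 1 1 1 3]) (auto dest: bounds)
  ultimately have low: "identifiable ?Q {v \<in> ?P. v ! 0 \<le> 2} 5"
    using identifiable_query[of 0 2 0 8 _ 4] by simp
  have "identifiable ?Q {v \<in> {v \<in> ?P. 2 < v ! 0}. v ! 0 \<le> 4} 4"
    by (rule identifiable_box_2[of _ _ 3 1 3 3]) (auto dest: bounds)
  moreover have "identifiable ?Q {v \<in> {v \<in> ?P. 2 < v ! 0}. 4 < v ! 0} 4"
    by (rule identifiable_box_2[of _ _ 5 2 5 2]) (auto dest: bounds)
  ultimately have high: "identifiable ?Q {v \<in> ?P. 2 < v ! 0} 5"
    using identifiable_query[of 0 2 4 8 _ 4] by simp
  show ?thesis
    using identifiable_query[of 0 2 2 8 _ 5] low high by (simp add: mergeable_def)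
qed

text \<open>The first comparison is $a_1$ with $b_2$. If $a_1$ is smaller, $a_3$ is compared with
  $b_5$, and if that is smaller too, $a_2$ with $b_2$ and then with $b_1$ or $b_3$. If $a_1 > b_2$,
  then $a_1$ is compared with $b_3$, and next $a_2$ with $b_3$ or $b_5$.\<close>

lemma mergeable_3_6: "mergeable 3 6 7"
proof -
  let ?Q = "queries 3 6" and ?P = "positions 3 6"
  note bounds = positions_3[of _ 6]
  note box = identifiable_box_3[of _ 6]
  note query = identifiable_query[of _ 3 _ 6]
  let ?L = "{v \<in> ?P. v ! 0 \<le> 1}" and ?H = "{v \<in> ?P. 1 < v ! 0}"
  let ?LL = "{v \<in> ?L. v ! 2 \<le> 4}"
  \<comment> \<open>Sortedness forces the first two entries to be 0, and the third has the five
    values 0 to 4.\<close>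
  have "identifiable ?Q {v \<in> {v \<in> ?LL. v ! 1 \<le> 1}. v ! 1 \<le> 0} 3"
    by (rule box[of _ 0 0 0 0 0 3]) (auto dest: bounds)
  moreover have "identifiable ?Q {v \<in> {v \<in> ?LL. v ! 1 \<le> 1}. 0 < v ! 1} 3"
    by (rule box[of _ 0 1 1 0 1 2]) (auto dest: bounds)
  ultimately have 1: "identifiable ?Q {v \<in> ?LL. v ! 1 \<le> 1} 4"
    using query[of 1 0 _ 3] by simp
  have "identifiable ?Q {v \<in> {v \<in> ?LL. 1 < v ! 1}. v ! 1 \<le> 2} 3"
    by (rule box[of _ 0 1 2 0 2 2]) (auto dest: bounds)
  moreover have "identifiable ?Q {v \<in> {v \<in> ?LL. 1 < v ! 1}. 2 < v ! 1} 3"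
    by (rule box[of _ 0 1 3 1 3 1]) (auto dest: bounds)
  ultimately have 2: "identifiable ?Q {v \<in> ?LL. 1 < v ! 1} 4"
    using query[of 1 2 _ 3] by simp
  have 3: "identifiable ?Q ?LL 5"
    using query[of 1 1 _ 4] 1 2 by simp
  \<comment> \<open>Here the first entry is 0 or 1 and the third 5 or 6, so even the full range of
    seven values for the second fits the budget.\<close>
  have "identifiable ?Q {v \<in> ?L. 4 < v ! 2} 5"
    by (rule box[of _ 0 1 0 3 5 1]) (auto dest: bounds)
  with 3 have low: "identifiable ?Q ?L 6"
    using query[of 2 4 _ 5] by simp
  have "identifiable ?Q {v \<in> {v \<in> ?H. v ! 0 \<le> 2}. v ! 1 \<le> 2} 4"
    by (rule box[of _ 2 0 2 0 2 3]) (auto dest: bounds)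
  moreover have "identifiable ?Q {v \<in> {v \<in> ?H. v ! 0 \<le> 2}. 2 < v ! 1} 4"
    by (rule box[of _ 2 0 3 2 3 2]) (auto dest: bounds)
  ultimately have 4: "identifiable ?Q {v \<in> ?H. v ! 0 \<le> 2} 5"
    using query[of 1 2 _ 4] by simp
  have "identifiable ?Q {v \<in> {v \<in> ?H. 2 < v ! 0}. v ! 1 \<le> 4} 4"
    by (rule box[of _ 3 1 3 1 3 2]) (auto dest: bounds)
  moreover have "identifiable ?Q {v \<in> {v \<in> ?H. 2 < v ! 0}. 4 < v ! 1} 4"
    by (rule box[of _ 3 2 5 1 5 1]) (auto dest: bounds)
  ultimately have 5: "identifiable ?Q {v \<in> ?H. 2 < v ! 0} 5"
    using query[of 1 4 _ 4] by simp
  have high: "identifiable ?Q ?H 6"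
    using query[of 0 2 _ 5] 4 5 by simp
  show ?thesis
    using query[of 0 1 _ 6] low high by (simp add: mergeable_def)
qed

section \<open>Induction from the base cases to the general bound\<close>

text \<open>Two further elements in the second list cost one more comparison. This family supplies
  the branch of \<open>mergeable_3\<close> in which $a_1$ has been placed.\<close>

lemma mergeable_2: "mergeable 2 (2 * k + 8) (k + 6)"
proof (induction k)
  case 0
  then show ?case by (simp add: mergeable_2_8)
next
  case (Suc k)
  \<comment> \<open>Binary insertion with budget \<open>k + 5\<close> handles fewer than
    \<open>2 ^ (k + 5)\<close> elements, which is the factor 32.\<close>
  have "2 * k + 10 < 32 * 2 ^ k" by (induction k) auto
  then have "mergeable 1 (2 * k + 8 + 2) (k + 5)" by (intro mergeable_1) (simp add: power_add)
  then show ?case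
    using mergeable_compare_second[of 1 "2 * k + 8" "k + 5"] Suc.IH
    by (simp add: numeral_eq_Suc)
qed

lemma mergeable_3: "mergeable 3 (2 * k + 6) (k + 7)"
proof (induction k)
  case 0
  then show ?case by (simp add: mergeable_3_6)
next
  case (Suc k)
  then show ?case
    using mergeable_compare_second[of 2 "2 * k + 6" "k + 6"] mergeable_2[of k]
    by (simp add: numeral_eq_Suc)
qed

text \<open>This is the claimed bound with \<open>m\<close> shifted by 3 and \<open>k\<close> by 1,
  so that both parameters start at 0.\<close>

lemma mergeable_double: "mergeable (m + 3) (2 * m + 2 * k + 4) (3 * m + k + 6)"
proof (induction m arbitrary: k)
  case 0
  show ?case
  proof (cases k)
    case 0
    then show ?thesis using mergeable_tape[of 3 4] by simp
  next
    case (Suc k')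
    then show ?thesis using mergeable_3[of k'] by (simp add: add.commute)
  qed
next
  case (Suc m)
  \<comment> \<open>The inner induction on \<open>k\<close> rebinds \<open>Suc.IH\<close>; the
    hypothesis on \<open>m\<close>, valid for every \<open>k\<close>, is kept under another
    name.\<close>
  note outer = Suc.IH
  show ?case
  proof (induction k)
    case 0
    then show ?case
      using mergeable_tape[of "Suc m + 3" "2 * Suc m + 4"] by (simp add: numeral_eq_Suc)
  next
    case (Suc k)
    \<comment> \<open>Removing $a_1$ with the second list unchanged raises the parameter from
      \<open>Suc k\<close> to \<open>k + 2\<close>, since the length of the second list is measured
      against twice that of the first.\<close>
    have "mergeable (m + 3) (2 * m + 2 * k + 6 + 2) (3 * m + k + 8)"
      using outer[of "Suc (Suc k)"] by (simp add: numeral_eq_Suc)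
    moreover have "mergeable (Suc (m + 3)) (2 * m + 2 * k + 6) (Suc (3 * m + k + 8))"
      using Suc.IH by (simp add: numeral_eq_Suc)
    ultimately show ?case
      using mergeable_compare_second[of "m + 3" "2 * m + 2 * k + 6" "3 * m + k + 8"]
      by (simp add: numeral_eq_Suc)
  qed
qed

section \<open>From position vectors to comparison algorithms\<close>

definition comparison_queries :: "elem set \<Rightarrow> (elem rel \<Rightarrow> bool) set" where
  "comparison_queries E = {\<lambda>R. (x, y) \<in> R | x y. x \<in> E \<and> y \<in> E \<and> x \<noteq> y}"

lemma identifiable_imp_algorithm:
  assumes "identifiable (comparison_queries E) S c"
  shows "\<exists>T. compares_within E T \<and> (\<forall>R\<in>S. run T R = R \<and> comparisons T R \<le> c)"
  using assms
proof induction
  case (leaf S c)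
  \<comment> \<open>A leaf outputs its only candidate; for empty \<open>S\<close> the output is
    arbitrary and the claim is vacuous.\<close>
  then have "\<forall>R\<in>S. (SOME R. R \<in> S) = R" by (metis someI)
  then show ?case by (intro exI[of _ "Output (SOME R. R \<in> S)"]) simp
next
  case (node q S c)
  obtain x y where "x \<in> E" "y \<in> E" "x \<noteq> y" "q = (\<lambda>R. (x, y) \<in> R)"
    using node.hyps(1) by (auto simp: comparison_queries_def)
  moreover obtain T U where
    "compares_within E T" "\<forall>R\<in>{R \<in> S. q R}. run T R = R \<and> comparisons T R \<le> c"
    "compares_within E U" "\<forall>R\<in>{R \<in> S. \<not> q R}. run U R = R \<and> comparisons U R \<le> c"
    using node.IH by blast
  ultimately show ?case by (intro exI[of _ "Compare x y T U"]) simp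
qed

lemma interleavings_not_less_iff:
  assumes "R \<in> interleavings m n" "i < m" "j < n"
  shows "(B j, A i) \<in> R \<longleftrightarrow> (A i, B j) \<notin> R"
proof -
  have "A i \<in> elems m n" "B j \<in> elems m n" using assms by (auto simp: elems_def)
  then show ?thesis
    using assms(1) unfolding interleavings_def strict_linear_order_on_def
    by (auto simp: total_on_def irrefl_def dest: transD)
qed

lemma interleavings_same_list:
  assumes "R \<in> interleavings m n"
  shows "(A i, A j) \<in> R \<longleftrightarrow> i < j \<and> j < m" "(B i, B j) \<in> R \<longleftrightarrow> i < j \<and> j < n"
proof -
  have R: "trans R" "irrefl R" "R \<subseteq> elems m n \<times> elems m n"
    "\<And>i j. i < j \<Longrightarrow> j < m \<Longrightarrow> (A i, A j) \<in> R" "\<And>i j. i < j \<Longrightarrow> j < n \<Longrightarrow> (B i, B j) \<in> R"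
    using assms by (auto simp: interleavings_def strict_linear_order_on_def)
  have bound: "i < m \<and> j < m" if "(A i, A j) \<in> R" for i j
    using subsetD[OF R(3) that] by (auto simp: elems_def)
  have bound': "i < n \<and> j < n" if "(B i, B j) \<in> R" for i j
    using subsetD[OF R(3) that] by (auto simp: elems_def)
  show "(A i, A j) \<in> R \<longleftrightarrow> i < j \<and> j < m"
    using R(4) bound R(1,2) by (metis irrefl_def linorder_neqE_nat transD)
  show "(B i, B j) \<in> R \<longleftrightarrow> i < j \<and> j < n"
    using R(5) bound' R(1,2) by (metis irrefl_def linorder_neqE_nat transD)
qed

text \<open>Comparisons within a list are the same in all interleavings, and those of a
  \<open>B\<close> with an \<open>A\<close> are the negations of the ones given.\<close>

lemma interleavings_eqI:
  assumes "R \<in> interleavings m n" "R' \<in> interleavings m n"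
    and "\<And>i j. i < m \<Longrightarrow> j < n \<Longrightarrow> (A i, B j) \<in> R \<longleftrightarrow> (A i, B j) \<in> R'"
  shows "R = R'"
proof -
  have sub: "R \<subseteq> elems m n \<times> elems m n" "R' \<subseteq> elems m n \<times> elems m n"
    using assms by (auto simp: interleavings_def)
  have "p \<in> R \<longleftrightarrow> p \<in> R'" if "p \<in> elems m n \<times> elems m n" for p
    using that assms(3) interleavings_same_list[OF assms(1)] interleavings_same_list[OF assms(2)]
      interleavings_not_less_iff[OF assms(1)] interleavings_not_less_iff[OF assms(2)]
    by (auto simp: elems_def)
  then show ?thesis using sub by blast
qed

definition position_vector :: "nat \<Rightarrow> nat \<Rightarrow> elem rel \<Rightarrow> nat list" where
  "position_vector m n R = map (\<lambda>i. card {j. j < n \<and> (B j, A i) \<in> R}) [0..<m]"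

text \<open>The \<open>B\<close>s below \<open>A i\<close> form an initial segment, so their number
  exceeds \<open>j\<close> exactly when \<open>B j\<close> is among them. This matches queries with
  comparisons.\<close>

lemma position_vector_le_iff:
  assumes R: "R \<in> interleavings m n" and ij: "i < m" "j < n"
  shows "position_vector m n R ! i \<le> j \<longleftrightarrow> (A i, B j) \<in> R"
proof -
  let ?X = "{j. j < n \<and> (B j, A i) \<in> R}"
  have trans: "trans R" using R by (simp add: interleavings_def strict_linear_order_on_def)
  have "card ?X \<le> j" if less: "(A i, B j) \<in> R"
  proof -
    have "?X \<subseteq> {..<j}"
    proof
      fix k assume k: "k \<in> ?X"
      then have "(B k, B j) \<in> R" using less trans by (auto dest: transD)
      then show "k \<in> {..<j}" using interleavings_same_list[OF R] by simp
    qed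
    then show ?thesis using card_mono[of "{..<j}" ?X] by simp
  qed
  moreover have "j < card ?X" if "(A i, B j) \<notin> R"
  proof -
    have Bj: "(B j, A i) \<in> R" using that interleavings_not_less_iff[OF R ij] by simp
    have "{..j} \<subseteq> ?X"
    proof
      fix k assume "k \<in> {..j}"
      then have "k = j \<or> (B k, B j) \<in> R" "k < n"
        using interleavings_same_list[OF R] ij by auto
      then show "k \<in> ?X" using Bj trans by (auto dest: transD)
    qed
    then show ?thesis using card_mono[of ?X "{..j}"] by simp
  qed
  moreover have "position_vector m n R ! i = card ?X"
    using ij by (simp add: position_vector_def)
  ultimately show ?thesis by (metis not_le)
qed

lemma position_vector_in_positions:
  assumes R: "R \<in> interleavings m n"
  shows "position_vector m n R \<in> positions m n"
proof -
  have trans: "trans R" using R by (simp add: interleavings_def strict_linear_order_on_def)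
  have "card {j. j < n \<and> (B j, A i) \<in> R} \<le> card {j. j < n \<and> (B j, A i') \<in> R}"
    if "i \<le> i'" "i' < m" for i i'
  proof (rule card_mono)
    have "i = i' \<or> (A i, A i') \<in> R" using that interleavings_same_list[OF R] by auto
    then show "{j. j < n \<and> (B j, A i) \<in> R} \<subseteq> {j. j < n \<and> (B j, A i') \<in> R}"
      using trans by (auto dest: transD)
  qed simp
  moreover have "card {j. j < n \<and> (B j, A i) \<in> R} \<le> n" for i
    using card_mono[of "{..<n}" "{j. j < n \<and> (B j, A i) \<in> R}"] by auto
  ultimately show ?thesis
    by (auto simp: positions_def position_vector_def sorted_iff_nth_mono)
qed

text \<open>The strategy is transferred along \<open>position_vector\<close>, which is injective
  because its entries determine all comparisons between the two lists; the resulting tree is a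
  merging algorithm with worst case at most \<open>c\<close>.\<close>

lemma mergeable_imp_M_le:
  assumes "mergeable m n c"
  shows "M m n \<le> c"
proof -
  have "identifiable (comparison_queries (elems m n)) (interleavings m n) c"
  proof (rule identifiable_transfer[of _ _ _ "position_vector m n"])
    show "identifiable (queries m n) (positions m n) c" using assms by (simp add: mergeable_def)
    show "inj_on (position_vector m n) (interleavings m n)"
      by (intro inj_onI interleavings_eqI) (auto simp flip: position_vector_le_iff)
    show "position_vector m n ` interleavings m n \<subseteq> positions m n"
      using position_vector_in_positions by blast
    show "\<exists>q'\<in>comparison_queries (elems m n).
        \<forall>R\<in>interleavings m n. q' R = q (position_vector m n R)"
      if q: "q \<in> queries m n" for q
    proof -
      obtain i j where "i < m" "j < n" "q = (\<lambda>v. v ! i \<le> j)"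
        using q by (auto simp: queries_def)
      then show ?thesis
        by (intro bexI[of _ "\<lambda>R. (A i, B j) \<in> R"])
          (auto simp: position_vector_le_iff comparison_queries_def elems_def)
    qed
  qed
  then obtain T where T: "compares_within (elems m n) T"
    "\<forall>R\<in>interleavings m n. run T R = R \<and> comparisons T R \<le> c"
    using identifiable_imp_algorithm by blast
  have "M m n \<le> worst_case m n T"
    unfolding M_def using T by (intro Least_le) (auto simp: merging_algorithm_def)
  also have "\<dots> \<le> c"
    unfolding worst_case_def using T(2) interleavings_nonempty by (subst Max_le_iff) auto
  finally show ?thesis .
qed

theorem theorem6:
  fixes m :: nat and k :: int
  assumes "m \<ge> 3" and "k \<ge> -1"
  shows "int (M m (nat (2 * int m + 2 * k))) \<le> 3 * int m + k - 2"
proof -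
  \<comment> \<open>The assumptions make \<open>m - 3\<close> and \<open>k + 1\<close> nonnegative,
    so truncated subtraction and \<open>nat\<close> lose nothing.\<close>
  define m' where "m' = m - 3"
  define k' where "k' = nat (k + 1)"
  have m: "m = m' + 3" and k: "k = int k' - 1"
    using assms by (auto simp: m'_def k'_def)
  have "nat (2 * int m + 2 * k) = 2 * m' + 2 * k' + 4"
    unfolding m k by simp
  then have "M m (nat (2 * int m + 2 * k)) \<le> 3 * m' + k' + 6"
    using mergeable_imp_M_le[OF mergeable_double[of m' k']] m by simp
  then show ?thesis unfolding k using m by linarith
qed

end
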